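(* There is a universal constant $C_0>0$ such that the following holds. Let $n\ge 1$, let $\alpha\in\mathbb{N}$ with $\alpha\ge 1$, let $\epsilon\in(0,1)$ and $\delta\in(0,1/2]$. Then there is an algorithm which, for every Hermitian operator $O$ on $n$ qubits with $\mathrm{tr}(O^2)=2^n$, estimates the $\alpha$-stabilizer purity $P^{(\alpha)}(O)=\sum_{k=1}^{4^n}\left(\mathrm{tr}(P_kO)/2^n\right)^{2\alpha}$ to additive error $\epsilon$ with success probability at least $1-\delta$, using $N\le C_0\,\alpha\log(1/\delta)/\epsilon^2$ copies (samples) of the state $|O\rangle\rangle_{\mathcal P}$, measured in the computational basis. That is, its output $\hat P$ satisfies $\Pr\left(|\hat P-P^{(\alpha)}(O)|\le\epsilon\right)\ge 1-\delta$.
   Context: $\mathcal P=\{I,X,Y,Z\}^{\otimes n}=\{P_1,\dots,P_{4^n}\}$ is the set of $n$-qubit Pauli operators. For an operator $O$ on $n$ qubits put $c_k=\mathrm{tr}(P_kO)/2^n$. Label the computational basis of the $2n$-qubit space $\mathbb{C}^{4^n}$ by $k\in\{1,\dots,4^n\}$. The vectorization of $O\neq 0$ in the Pauli basis is the unit vector $|O\rangle\rangle_{\mathcal P}=\sum_k \frac{c_k}{\sqrt{\sum_i|c_i|^2}}|k\rangle$ (possible fixed phases in front of the $|k\rangle$ are irrelevant here). Measuring one copy in the computational basis returns $k$ with probability $|\langle k|O\rangle\rangle_{\mathcal P}|^2$, independently for different copies. An "algorithm" is a (possibly randomized) classical post-processing of the measurement outcomes which may depend on $n,\alpha,\epsilon,\delta$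 but has no access to $O$ other than through the outcomes. *)

theory Defs
  imports
    "HOL-Probability.Probability"
    "Jordan_Normal_Form.Schur_Decomposition"
begin

definition mat_trace :: "'a::comm_monoid_add mat \<Rightarrow> 'a" where
  "mat_trace A = (\<Sum>i<dim_row A. A $$ (i, i))"

definition hermitian_mat :: "complex mat \<Rightarrow> bool" where
  "hermitian_mat A \<longleftrightarrow> mat_adjoint A = A"

definition kron :: "'a::semiring_1 mat \<Rightarrow> 'a mat \<Rightarrow> 'a mat" (infixr "\<otimes>\<^sub>m" 72) where
  "A \<otimes>\<^sub>m B = mat (dim_row A * dim_row B) (dim_col A * dim_col B)
     (\<lambda>(i, j). A $$ (i div dim_row B, j div dim_col B) * B $$ (i mod dim_row B, j mod dim_col B))"

definition pauli_X :: "complex mat" where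
  "pauli_X = mat_of_rows_list 2 [[0, 1], [1, 0]]"

definition pauli_Y :: "complex mat" where
  "pauli_Y = mat_of_rows_list 2 [[0, - \<i>], [\<i>, 0]]"

definition pauli_Z :: "complex mat" where
  "pauli_Z = mat_of_rows_list 2 [[1, 0], [0, - 1]]"

definition pauli_strings :: "nat \<Rightarrow> complex mat list list" where
  "pauli_strings n = List.n_lists n [1\<^sub>m 2, pauli_X, pauli_Y, pauli_Z]"

(* Pauli operators and basis states are labelled by k < 4 ^ n, i.e. from 0 rather than from 1. *)
definition pauli_op :: "nat \<Rightarrow> nat \<Rightarrow> complex mat" where
  "pauli_op n k = foldr (\<otimes>\<^sub>m) (pauli_strings n ! k) (1\<^sub>m 1)"

definition pauli_coeff :: "nat \<Rightarrow> complex mat \<Rightarrow> nat \<Rightarrow> complex" where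
  "pauli_coeff n A k = mat_trace (pauli_op n k * A) / 2 ^ n"

(* Complex-valued; for Hermitian A every coefficient, hence also this sum, is real. *)
definition stab_purity :: "nat \<Rightarrow> nat \<Rightarrow> complex mat \<Rightarrow> complex" where
  "stab_purity n \<alpha> A = (\<Sum>k<4 ^ n. pauli_coeff n A k ^ (2 * \<alpha>))"

definition pauli_vec :: "nat \<Rightarrow> complex mat \<Rightarrow> complex Matrix.vec" where
  "pauli_vec n A = Matrix.vec (4 ^ n)
     (\<lambda>k. pauli_coeff n A k / complex_of_real (sqrt (\<Sum>i<4 ^ n. (cmod (pauli_coeff n A i))\<^sup>2)))"

(* Born rule for a computational-basis measurement; meaningful for unit vectors only,
   see pmf_measure_basis. *)
definition measure_basis :: "complex Matrix.vec \<Rightarrow> nat pmf" where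
  "measure_basis v = embed_pmf (\<lambda>k. if k < dim_vec v then (cmod (vec_index v k))\<^sup>2 else 0)"

lemma length_pauli_strings: "length (pauli_strings n) = 4 ^ n"
  unfolding pauli_strings_def
  by (induction n) (simp_all add: length_concat comp_def sum_list_triv)

lemma pmf_measure_basis:
  assumes "(\<Sum>k<dim_vec v. (cmod (vec_index v k))\<^sup>2) = 1"
  shows "pmf (measure_basis v) k = (if k < dim_vec v then (cmod (vec_index v k))\<^sup>2 else 0)"
  unfolding measure_basis_def
proof (rule pmf_embed_pmf)
  let ?f = "\<lambda>k. if k < dim_vec v then (cmod (vec_index v k))\<^sup>2 else 0"
  have "(\<integral>\<^sup>+k. ennreal (?f k) \<partial>count_space UNIV) = (\<Sum>k<dim_vec v. ennreal (?f k))"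
    by (rule nn_integral_count_space'[of "{..<dim_vec v}"]) auto
  also have "\<dots> = ennreal (\<Sum>k<dim_vec v. ?f k)"
    by (rule sum_ennreal) simp
  finally show "(\<integral>\<^sup>+k. ennreal (?f k) \<partial>count_space UNIV) = 1"
    using assms by simp
qed simp

lemma norm_pauli_vec:
  assumes "\<exists>k<4 ^ n. pauli_coeff n A k \<noteq> 0"
  shows "(\<Sum>k<dim_vec (pauli_vec n A). (cmod (vec_index (pauli_vec n A) k))\<^sup>2) = 1"
proof -
  define s where "s = (\<Sum>i<4 ^ n. (cmod (pauli_coeff n A i))\<^sup>2)"
  have "s > 0"
    unfolding s_def using assms by (auto intro!: sum_pos2)
  then have "(\<Sum>k<4 ^ n. (cmod (pauli_coeff n A k / complex_of_real (sqrt s)))\<^sup>2) = s / s"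
    unfolding s_def by (simp add: norm_divide power_divide sum_nonneg flip: sum_divide_distrib)
  then show ?thesis
    using \<open>s > 0\<close> by (simp add: pauli_vec_def flip: s_def)
qed

end

theory Submission
  imports Defs
begin

text \<open>
  Completeness of the Pauli basis, \<open>\<Sum>\<^sub>k P\<^sub>k \<otimes> P\<^sub>k = 2\<^sup>n SWAP\<close>, turns \<open>tr (O\<^sup>2) = 2\<^sup>n\<close> into
  \<open>\<Sum>\<^sub>k c\<^sub>k\<^sup>2 = 1\<close>, and the \<open>c\<^sub>k\<close> are real, so that a measurement returns \<open>k\<close> with probability
  \<open>c\<^sub>k\<^sup>2\<close>. Hence \<open>\<alpha>\<close> independent outcomes all coincide with probability
  \<open>\<Sum>\<^sub>k c\<^sub>k\<^sup>2\<^sup>\<alpha>\<close>, the stabilizer purity. The estimator is the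
  fraction of coinciding blocks among \<open>m\<close> disjoint blocks of \<open>\<alpha>\<close> outcomes; Hoeffding's inequality
  gives \<open>m = O(log (1/\<delta>) / \<epsilon>\<^sup>2)\<close>.
\<close>

section \<open>Completeness of the Pauli basis\<close>

abbreviation kron_list :: "complex mat list \<Rightarrow> complex mat" where
  "kron_list s \<equiv> foldr (\<otimes>\<^sub>m) s (1\<^sub>m 1)"

text \<open>\<open>List.n_lists\<close> lengthens a string by prepending a letter, so inductions on
  \<open>n\<close> split off the leftmost tensor factor.\<close>

lemma sum_pauli_strings_Suc:
  "(\<Sum>s\<leftarrow>pauli_strings (Suc n). g s) =
   (\<Sum>s\<leftarrow>pauli_strings n. \<Sum>y\<leftarrow>[1\<^sub>m 2, pauli_X, pauli_Y, pauli_Z]. g (y # s))"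
proof -
  have "(\<Sum>s\<leftarrow>concat (map (\<lambda>s. map (\<lambda>y. y # s) ys) zs). g s) = (\<Sum>s\<leftarrow>zs. \<Sum>y\<leftarrow>ys. g (y # s))"
    for ys zs
    by (induction zs) (simp_all add: o_def)
  then show ?thesis
    unfolding pauli_strings_def List.n_lists.simps .
qed

lemma pauli_strings_Suc_cases:
  assumes "s \<in> set (pauli_strings (Suc n))"
  obtains y t where "s = y # t" "y \<in> {1\<^sub>m 2, pauli_X, pauli_Y, pauli_Z}" "t \<in> set (pauli_strings n)"
  using assms unfolding pauli_strings_def by auto

section \<open>Single-qubit Pauli matrices\<close>

lemma single_pauli_carrier:
  "y \<in> {1\<^sub>m 2, pauli_X, pauli_Y, pauli_Z} \<Longrightarrow> y \<in> carrier_mat 2 2"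
  by (auto simp: pauli_X_def pauli_Y_def pauli_Z_def mat_of_rows_list_def)

lemma single_pauli_hermitian:
  assumes "y \<in> {1\<^sub>m 2, pauli_X, pauli_Y, pauli_Z}" "i < 2" "j < 2"
  shows "cnj (y $$ (i, j)) = y $$ (j, i)"
  using assms(1) less_2_cases[OF assms(2)] less_2_cases[OF assms(3)]
  by (auto simp: pauli_X_def pauli_Y_def pauli_Z_def mat_of_rows_list_def)

text \<open>This is the sum of P tensor P = 2 SWAP on one qubit, read off at row (i, l) and column
  (j, m); all sixteen entries are checked.\<close>

lemma single_pauli_swap:
  assumes "i < 2" "j < 2" "l < 2" "m < 2"
  shows "(\<Sum>y\<leftarrow>[1\<^sub>m 2, pauli_X, pauli_Y, pauli_Z]. y $$ (i, j) * y $$ (l, m)) =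
    (if i = m \<and> j = l then 2 else 0)"
  using less_2_cases[OF assms(1)] less_2_cases[OF assms(2)]
    less_2_cases[OF assms(3)] less_2_cases[OF assms(4)]
  by (elim disjE) (simp_all add: pauli_X_def pauli_Y_def pauli_Z_def mat_of_rows_list_def)

section \<open>Entries of tensor products of Pauli matrices\<close>

lemma kron_carrier:
  "A \<in> carrier_mat a b \<Longrightarrow> B \<in> carrier_mat c d \<Longrightarrow> A \<otimes>\<^sub>m B \<in> carrier_mat (a * c) (b * d)"
  by (auto simp: kron_def)

lemma index_kron:
  assumes "A \<in> carrier_mat a b" "B \<in> carrier_mat c d" "i < a * c" "j < b * d"
  shows "(A \<otimes>\<^sub>m B) $$ (i, j) = A $$ (i div c, j div d) * B $$ (i mod c, j mod d)"
  using assms by (auto simp: kron_def)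

lemma kron_list_carrier:
  "s \<in> set (pauli_strings n) \<Longrightarrow> kron_list s \<in> carrier_mat (2 ^ n) (2 ^ n)"
proof (induction n arbitrary: s)
  case 0
  then show ?case by (simp add: pauli_strings_def)
next
  case (Suc n)
  from Suc.prems obtain y t where *: "s = y # t" "y \<in> {1\<^sub>m 2, pauli_X, pauli_Y, pauli_Z}"
    "t \<in> set (pauli_strings n)" by (rule pauli_strings_Suc_cases)
  show ?case
    using kron_carrier[OF single_pauli_carrier[OF *(2)] Suc.IH[OF *(3)]] *(1) by simp
qed

text \<open>The leading factor acts on the most significant bit of the index, which is the quotient
  by \<open>2 ^ n\<close>; the other factors act on the remainder.\<close>

lemma index_kron_list_Cons:
  assumes "y \<in> {1\<^sub>m 2, pauli_X, pauli_Y, pauli_Z}" "s \<in> set (pauli_strings n)"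
    "i < 2 ^ Suc n" "j < 2 ^ Suc n"
  shows "kron_list (y # s) $$ (i, j) =
    y $$ (i div 2 ^ n, j div 2 ^ n) * kron_list s $$ (i mod 2 ^ n, j mod 2 ^ n)"
  using index_kron[OF single_pauli_carrier[OF assms(1)] kron_list_carrier[OF assms(2)]] assms(3,4)
  by simp

lemma div_power2_less_2: "i < 2 ^ Suc n \<Longrightarrow> i div 2 ^ n < (2::nat)"
  by (simp add: less_mult_imp_div_less)

lemma kron_list_hermitian:
  "s \<in> set (pauli_strings n) \<Longrightarrow> i < 2 ^ n \<Longrightarrow> j < 2 ^ n \<Longrightarrow>
    cnj (kron_list s $$ (i, j)) = kron_list s $$ (j, i)"
proof (induction n arbitrary: s i j)
  case 0
  then show ?case by (simp add: pauli_strings_def)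
next
  case (Suc n)
  from Suc.prems(1) obtain y t where *: "s = y # t" "y \<in> {1\<^sub>m 2, pauli_X, pauli_Y, pauli_Z}"
    "t \<in> set (pauli_strings n)" by (rule pauli_strings_Suc_cases)
  have "cnj (kron_list t $$ (i mod 2 ^ n, j mod 2 ^ n)) = kron_list t $$ (j mod 2 ^ n, i mod 2 ^ n)"
    by (rule Suc.IH[OF *(3)]) auto
  then show ?case
    using single_pauli_hermitian[OF *(2) div_power2_less_2[OF Suc.prems(2)]
        div_power2_less_2[OF Suc.prems(3)]] Suc.prems(2,3)
    by (simp only: *(1) index_kron_list_Cons[OF *(2,3)] complex_cnj_mult)
qed

text \<open>Induction over the tensor factors: the sum over strings factors into a sum over the head
  letter, evaluated by \<open>single_pauli_swap\<close>, and a sum over the tail. The SWAP of the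
  whole space is the product of the two partial SWAPs.\<close>

lemma pauli_strings_swap:
  "i < 2 ^ n \<Longrightarrow> j < 2 ^ n \<Longrightarrow> l < 2 ^ n \<Longrightarrow> m < 2 ^ n \<Longrightarrow>
    (\<Sum>s\<leftarrow>pauli_strings n. kron_list s $$ (i, j) * kron_list s $$ (l, m)) =
    (if i = m \<and> j = l then 2 ^ n else 0)"
proof (induction n arbitrary: i j l m)
  case 0
  then show ?case by (simp add: pauli_strings_def)
next
  case (Suc n)
  let ?P = "[1\<^sub>m 2, pauli_X, pauli_Y, pauli_Z]"
  let ?d = "\<lambda>i::nat. i div 2 ^ n" and ?r = "\<lambda>i::nat. i mod 2 ^ n"
  have "(\<Sum>s\<leftarrow>pauli_strings (Suc n). kron_list s $$ (i, j) * kron_list s $$ (l, m)) =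
    (\<Sum>s\<leftarrow>pauli_strings n. \<Sum>y\<leftarrow>?P. kron_list (y # s) $$ (i, j) * kron_list (y # s) $$ (l, m))"
    by (rule sum_pauli_strings_Suc)
  also have "\<dots> = (\<Sum>s\<leftarrow>pauli_strings n. \<Sum>y\<leftarrow>?P.
      (y $$ (?d i, ?d j) * kron_list s $$ (?r i, ?r j)) *
      (y $$ (?d l, ?d m) * kron_list s $$ (?r l, ?r m)))"
    using Suc.prems by (intro arg_cong[of _ _ sum_list] map_cong refl)
      (simp only: index_kron_list_Cons list.set)
  also have "\<dots> = (\<Sum>s\<leftarrow>pauli_strings n.
      (\<Sum>y\<leftarrow>?P. y $$ (?d i, ?d j) * y $$ (?d l, ?d m)) *
      (kron_list s $$ (?r i, ?r j) * kron_list s $$ (?r l, ?r m)))"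
    by (intro arg_cong[of _ _ sum_list] map_cong refl) (simp add: algebra_simps)
  also have "\<dots> = (if ?d i = ?d m \<and> ?d j = ?d l then 2 else 0) *
      (\<Sum>s\<leftarrow>pauli_strings n. kron_list s $$ (?r i, ?r j) * kron_list s $$ (?r l, ?r m))"
    by (simp only: single_pauli_swap[OF Suc.prems[THEN div_power2_less_2]] sum_list_const_mult)
  also have "\<dots> = (if ?d i = ?d m \<and> ?d j = ?d l then 2 else 0) *
      (if ?r i = ?r m \<and> ?r j = ?r l then 2 ^ n else 0)"
    by (subst Suc.IH) simp_all
  also have "\<dots> = (if i = m \<and> j = l then 2 ^ Suc n else 0)"
  proof -
    \<comment> \<open>Quotient and remainder determine an index, so the two partial conditions merge
      into one.\<close>
    have "?d a = ?d b \<and> ?r a = ?r b \<longleftrightarrow> a = b" for a b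
      by (metis div_mult_mod_eq)
    then show ?thesis by auto
  qed
  finally show ?case .
qed

lemma pauli_op_eq: "pauli_op n k = kron_list (pauli_strings n ! k)"
  by (simp add: pauli_op_def)

lemma pauli_op_carrier: "k < 4 ^ n \<Longrightarrow> pauli_op n k \<in> carrier_mat (2 ^ n) (2 ^ n)"
  unfolding pauli_op_eq by (rule kron_list_carrier) (simp add: length_pauli_strings)

lemma pauli_op_hermitian:
  assumes "k < 4 ^ n" "i < 2 ^ n" "j < 2 ^ n"
  shows "cnj (pauli_op n k $$ (i, j)) = pauli_op n k $$ (j, i)"
  unfolding pauli_op_eq
  by (rule kron_list_hermitian) (use assms in \<open>simp_all add: length_pauli_strings\<close>)

lemma pauli_op_swap:
  assumes "i < 2 ^ n" "j < 2 ^ n" "l < 2 ^ n" "m < 2 ^ n"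
  shows "(\<Sum>k<4 ^ n. pauli_op n k $$ (i, j) * pauli_op n k $$ (l, m)) =
    (if i = m \<and> j = l then 2 ^ n else 0)"
  unfolding pauli_strings_swap[OF assms, symmetric] pauli_op_eq
  by (simp add: sum_list_sum_nth length_pauli_strings atLeast0LessThan)

section \<open>Pauli coefficients: reality and Parseval identity\<close>

lemma mat_trace_mult:
  assumes "A \<in> carrier_mat a b" "B \<in> carrier_mat b a"
  shows "mat_trace (A * B) = (\<Sum>i<a. \<Sum>j<b. A $$ (i, j) * B $$ (j, i))"
  using assms by (simp add: mat_trace_def scalar_prod_def atLeast0LessThan)

lemma hermitian_mat_index:
  assumes "hermitian_mat A" "A \<in> carrier_mat d d" "i < d" "j < d"
  shows "cnj (A $$ (i, j)) = A $$ (j, i)"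
proof -
  have "A $$ (j, i) = mat_adjoint A $$ (j, i)"
    using assms(1) by (simp add: hermitian_mat_def)
  also have "\<dots> = cnj (A $$ (i, j))"
    using assms(2-4) by (simp add: mat_adjoint_def mat_of_rows_def)
  finally show ?thesis by simp
qed

text \<open>Conjugation transposes both Hermitian factors entrywise, which only exchanges the two
  summation indices of the trace.\<close>

lemma pauli_coeff_real:
  assumes A: "A \<in> carrier_mat (2 ^ n) (2 ^ n)" and "hermitian_mat A" and k: "k < 4 ^ n"
  shows "pauli_coeff n A k \<in> \<real>"
proof -
  let ?P = "pauli_op n k"
  have "cnj (mat_trace (?P * A)) = (\<Sum>i<2 ^ n. \<Sum>j<2 ^ n. ?P $$ (j, i) * A $$ (i, j))"
    by (simp add: mat_trace_mult[OF pauli_op_carrier[OF k] A] pauli_op_hermitian[OF k]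
        hermitian_mat_index[OF assms(2) A])
  also have "\<dots> = mat_trace (?P * A)"
    unfolding mat_trace_mult[OF pauli_op_carrier[OF k] A] by (rule sum.swap)
  finally show ?thesis
    by (simp add: pauli_coeff_def Reals_cnj_iff)
qed

text \<open>The square of a trace is a fourfold sum of entries. Moving the sum over \<open>k\<close>
  innermost exposes the completeness relation. Its factor \<open>2 ^ n\<close> cancels one of the
  two factors \<open>2 ^ n\<close> from the squared normalization of \<open>pauli_coeff\<close>. The
  squares carry no modulus, hence the trace of \<open>A * A\<close>.\<close>

lemma sum_pauli_coeff_square:
  assumes A: "A \<in> carrier_mat (2 ^ n) (2 ^ n)"
  shows "(\<Sum>k<4 ^ n. (pauli_coeff n A k)\<^sup>2) = mat_trace (A * A) / 2 ^ n"
proof -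
  let ?D = "{..<(2::nat) ^ n}" and ?P = "pauli_op n"
  have "(\<Sum>k<4 ^ n. (mat_trace (?P k * A))\<^sup>2) =
    (\<Sum>k<4 ^ n. \<Sum>i\<in>?D. \<Sum>j\<in>?D. \<Sum>l\<in>?D. \<Sum>m\<in>?D.
      A $$ (j, i) * A $$ (m, l) * (?P k $$ (i, j) * ?P k $$ (l, m)))"
    by (intro sum.cong refl)
      (simp add: mat_trace_mult[OF pauli_op_carrier A] power2_eq_square sum_distrib_right,
        simp add: sum_distrib_left mult_ac)
  also have "\<dots> = (\<Sum>i\<in>?D. \<Sum>j\<in>?D. \<Sum>l\<in>?D. \<Sum>m\<in>?D. \<Sum>k<4 ^ n.
      A $$ (j, i) * A $$ (m, l) * (?P k $$ (i, j) * ?P k $$ (l, m)))"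
    by (subst sum.swap, rule sum.cong[OF refl], subst sum.swap, rule sum.cong[OF refl],
        subst sum.swap, rule sum.cong[OF refl], rule sum.swap)
  \<comment> \<open>Completeness kills all terms except those with \<open>i = m\<close> and
    \<open>j = l\<close>; nested conditionals let \<open>simp\<close> collapse the sums over
    \<open>l\<close> and \<open>m\<close>.\<close>
  also have "\<dots> = (\<Sum>i\<in>?D. \<Sum>j\<in>?D. \<Sum>l\<in>?D. \<Sum>m\<in>?D.
      if i = m then if j = l then A $$ (j, i) * A $$ (m, l) * 2 ^ n else 0 else 0)"
    by (intro sum.cong refl) (simp add: pauli_op_swap flip: sum_distrib_left)
  also have "\<dots> = (\<Sum>i\<in>?D. \<Sum>j\<in>?D. A $$ (j, i) * A $$ (i, j) * 2 ^ n)"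
    by simp
  also have "\<dots> = 2 ^ n * mat_trace (A * A)"
    by (simp add: mat_trace_mult[OF A A] sum_distrib_left mult_ac)
  finally show ?thesis
    by (simp add: pauli_coeff_def power_divide power2_eq_square flip: sum_divide_distrib)
qed

section \<open>Distribution of the measurement outcomes\<close>

lemma pmf_measure_pauli_vec:
  assumes A: "A \<in> carrier_mat (2 ^ n) (2 ^ n)" "hermitian_mat A" "mat_trace (A * A) = 2 ^ n"
  shows "pmf (measure_basis (pauli_vec n A)) k =
    (if k < 4 ^ n then (cmod (pauli_coeff n A k))\<^sup>2 else 0)"
proof -
  \<comment> \<open>Parseval concerns plain squares, the Born rule squared moduli; they agree
    because the coefficients are real.\<close>
  have sq: "complex_of_real ((cmod (pauli_coeff n A k))\<^sup>2) = (pauli_coeff n A k)\<^sup>2"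
    if "k < 4 ^ n" for k
    using pauli_coeff_real[OF A(1,2) that] by (auto elim!: Reals_cases simp flip: of_real_power)
  have "complex_of_real (\<Sum>k<4 ^ n. (cmod (pauli_coeff n A k))\<^sup>2) = 1"
    using sum_pauli_coeff_square[OF A(1)] A(3) by (simp add: sq del: of_real_power)
  then have norm: "(\<Sum>k<4 ^ n. (cmod (pauli_coeff n A k))\<^sup>2) = 1"
    by (simp only: of_real_eq_1_iff)
  \<comment> \<open>Since the squared moduli sum to 1, the vector is well defined and the square
    root in \<open>pauli_vec\<close> equals 1.\<close>
  then have "\<exists>k<4 ^ n. pauli_coeff n A k \<noteq> 0"
    by (metis (no_types, lifting) lessThan_iff norm_zero power_zero_numeral sum.neutral zero_neq_one)
  from pmf_measure_basis[OF norm_pauli_vec[OF this], of k] show ?thesis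
    using norm by (simp add: pauli_vec_def)
qed

lemma stab_purity_eq:
  assumes "A \<in> carrier_mat (2 ^ n) (2 ^ n)" "hermitian_mat A" "mat_trace (A * A) = 2 ^ n"
  shows "stab_purity n a A =
    complex_of_real (\<Sum>k<4 ^ n. pmf (measure_basis (pauli_vec n A)) k ^ a)"
  unfolding stab_purity_def of_real_sum
proof (intro sum.cong refl)
  fix k :: nat assume "k \<in> {..<4 ^ n}"
  then have k: "k < 4 ^ n" by simp
  show "pauli_coeff n A k ^ (2 * a) =
    complex_of_real (pmf (measure_basis (pauli_vec n A)) k ^ a)"
    using pauli_coeff_real[OF assms(1,2) k] k
    by (auto elim!: Reals_cases simp: pmf_measure_pauli_vec[OF assms] power_mult
        simp flip: of_real_power)
qed

section \<open>Counting coincident blocks\<close>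

text \<open>The recursion peels off one block at a time, matching both the splitting of
  \<open>replicate_pmf (Suc m * a) p\<close> into independent parts and the recursion of the
  binomial distribution.\<close>

fun coincident_blocks :: "nat \<Rightarrow> nat \<Rightarrow> 'a list \<Rightarrow> nat" where
  "coincident_blocks a 0 xs = 0"
| "coincident_blocks a (Suc m) xs =
    of_bool (\<exists>x. take a xs = replicate a x) + coincident_blocks a m (drop a xs)"

lemma pmf_replicate_pmf_replicate: "pmf (replicate_pmf a p) (replicate a x) = pmf p x ^ a"
proof (induction a)
  case (Suc a)
  have "replicate_pmf (Suc a) p = map_pmf (\<lambda>(x, xs). x # xs) (pair_pmf p (replicate_pmf a p))"
    by (simp add: pair_pmf_def map_bind_pmf)
  moreover have "pmf (map_pmf (\<lambda>(x, xs). x # xs) (pair_pmf p (replicate_pmf a p)))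
      ((\<lambda>(x, xs). x # xs) (x, replicate a x)) = pmf (pair_pmf p (replicate_pmf a p)) (x, replicate a x)"
    by (rule pmf_map_inj') (auto intro!: injI)
  ultimately show ?case
    by (simp add: pmf_pair Suc.IH)
qed simp

lemma bool_pmf_eq_bernoulli: "p = bernoulli_pmf (pmf p True)"
proof (rule pmf_eqI)
  fix b show "pmf p b = pmf (bernoulli_pmf (pmf p True)) b"
    by (cases b) (simp_all add: pmf_le_1 pmf_False_conv_True)
qed

text \<open>A constant block repeats a single value \<open>x\<close>, which by independence has
  probability \<open>pmf p x ^ a\<close>; these events are disjoint for different \<open>x\<close>,
  so the probabilities add up.\<close>

lemma coincident_block_bernoulli:
  assumes S: "finite S" "set_pmf p \<subseteq> S" and a: "a \<ge> 1"
  shows "map_pmf (\<lambda>xs. \<exists>x. xs = replicate a x) (replicate_pmf a p) =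
    bernoulli_pmf (\<Sum>x\<in>S. pmf p x ^ a)"
proof -
  let ?p = "replicate_pmf a p"
  \<comment> \<open>For \<open>a = 0\<close> all these lists would be empty and the events would
    coincide.\<close>
  have inj: "inj_on (replicate a) S"
    using a by (auto intro!: inj_onI simp: replicate_eq_replicate)
  have "pmf (map_pmf (\<lambda>xs. \<exists>x. xs = replicate a x) ?p) True =
      measure_pmf.prob ?p {xs. \<exists>x. xs = replicate a x}"
    by (simp add: pmf_map vimage_def)
  \<comment> \<open>The constant blocks left out repeat a value outside the support and have
    probability 0.\<close>
  also have "\<dots> = measure_pmf.prob ?p (replicate a ` S)"
    using S(2) a by (intro measure_prob_cong_0) (auto simp: image_iff pmf_eq_0_set_pmf set_replicate_pmf)
  also have "\<dots> = (\<Sum>x\<in>S. pmf p x ^ a)"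
    using S(1) inj by (simp add: measure_measure_pmf_finite sum.reindex pmf_replicate_pmf_replicate)
  finally show ?thesis
    using bool_pmf_eq_bernoulli by metis
qed

text \<open>The blocks are disjoint stretches of an i.i.d. sample, so their indicators are
  independent Bernoulli variables with the same parameter \<open>q\<close>.\<close>

lemma coincident_blocks_binomial:
  assumes S: "finite S" "set_pmf p \<subseteq> S" and a: "a \<ge> 1"
  defines "q \<equiv> \<Sum>x\<in>S. pmf p x ^ a"
  assumes q: "q \<in> {0..1}"
  shows "map_pmf (coincident_blocks a m) (replicate_pmf (m * a) p) = binomial_pmf m q"
proof (induction m)
  case 0
  then show ?case using q by (simp add: binomial_pmf_0)
next
  case (Suc m)
  have "map_pmf (coincident_blocks a (Suc m)) (replicate_pmf (Suc m * a) p) =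
    do {xs \<leftarrow> replicate_pmf a p; ys \<leftarrow> replicate_pmf (m * a) p;
        return_pmf (coincident_blocks a (Suc m) (xs @ ys))}"
    by (simp add: replicate_pmf_distrib map_bind_pmf)
  also have "\<dots> = do {xs \<leftarrow> replicate_pmf a p; ys \<leftarrow> replicate_pmf (m * a) p;
        return_pmf (of_bool (\<exists>x. xs = replicate a x) + coincident_blocks a m ys)}"
    by (intro bind_pmf_cong refl) (simp add: set_replicate_pmf)
  also have "\<dots> = do {b \<leftarrow> map_pmf (\<lambda>xs. \<exists>x. xs = replicate a x) (replicate_pmf a p);
        k \<leftarrow> map_pmf (coincident_blocks a m) (replicate_pmf (m * a) p);
        return_pmf (of_bool b + k)}"
    by (simp add: bind_map_pmf)
  also have "\<dots> = do {b \<leftarrow> bernoulli_pmf q; k \<leftarrow> binomial_pmf m q; return_pmf (of_bool b + k)}"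
    unfolding Suc.IH coincident_block_bernoulli[OF S a] q_def ..
  also have "\<dots> = binomial_pmf (Suc m) q"
    unfolding binomial_pmf_Suc[OF q] by (simp add: of_bool_def)
  finally show ?case .
qed

section \<open>Concentration of the estimator and number of blocks\<close>

lemma sum_pmf_power_bounds:
  assumes "finite S" "a \<ge> 1"
  shows "(\<Sum>x\<in>S. pmf p x ^ a) \<in> {0..1}"
proof -
  have "(\<Sum>x\<in>S. pmf p x ^ a) \<le> (\<Sum>x\<in>S. pmf p x ^ 1)"
    by (intro sum_mono power_decreasing) (use assms in \<open>auto simp: pmf_le_1\<close>)
  also have "\<dots> = measure_pmf.prob p S"
    using assms by (simp add: measure_measure_pmf_finite)
  finally show ?thesis
    by (simp add: sum_nonneg order_trans[OF _ measure_pmf.prob_le_1])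
qed

text \<open>The count is binomial with mean \<open>m * q\<close>, so Hoeffding's inequality applies
  to the fraction of coincident blocks.\<close>

lemma coincident_blocks_estimate:
  fixes \<epsilon> :: real
  assumes S: "finite S" "set_pmf p \<subseteq> S" and a: "a \<ge> 1" and "m > 0" "\<epsilon> \<ge> 0"
  shows "measure_pmf.prob (replicate_pmf (m * a) p)
      {xs. \<bar>coincident_blocks a m xs / m - (\<Sum>x\<in>S. pmf p x ^ a)\<bar> \<le> \<epsilon>}
    \<ge> 1 - 2 * exp (- 2 * m * \<epsilon>\<^sup>2)"
proof -
  define q where "q = (\<Sum>x\<in>S. pmf p x ^ a)"
  have q: "q \<in> {0..1}"
    unfolding q_def by (rule sum_pmf_power_bounds[OF S(1) a])
  interpret binomial_distribution m q
    by unfold_locales (rule q)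
  let ?B = "binomial_pmf m q"
  have "1 - 2 * exp (- 2 * m * \<epsilon>\<^sup>2) \<le> 1 - measure_pmf.prob ?B {k. \<bar>k / m - q\<bar> \<ge> \<epsilon>}"
    using prob_abs_ge'[OF \<open>m > 0\<close> \<open>\<epsilon> \<ge> 0\<close>] by simp
  also have "\<dots> = measure_pmf.prob ?B (UNIV - {k. \<bar>k / m - q\<bar> \<ge> \<epsilon>})"
    using measure_pmf.prob_compl[of "{k. \<bar>k / m - q\<bar> \<ge> \<epsilon>}" ?B] by simp
  \<comment> \<open>The tail event includes deviation exactly \<epsilon>, so its complement is a
    strict inequality, contained in the desired event.\<close>
  also have "\<dots> \<le> measure_pmf.prob ?B {k. \<bar>k / m - q\<bar> \<le> \<epsilon>}"
    by (intro measure_pmf.finite_measure_mono) auto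
  also have "?B = map_pmf (coincident_blocks a m) (replicate_pmf (m * a) p)"
    using coincident_blocks_binomial[OF S a] q unfolding q_def by simp
  finally show ?thesis
    by (simp add: vimage_def q_def)
qed

text \<open>Put L = ln (1/\<delta>). As \<delta> \<le> 1/2, ln (2/\<delta>) \<le> 2 L, so the real
  threshold is at most L/\<epsilon>^2. Rounding up costs at most 1 \<le> 2 L/\<epsilon>^2, because L
  \<ge> ln 2 \<ge> 1/2 and \<epsilon> < 1. This gives the constant 3.\<close>

lemma block_number:
  fixes \<epsilon> \<delta> :: real
  assumes "0 < \<epsilon>" "\<epsilon> < 1" "0 < \<delta>" "\<delta> \<le> 1 / 2"
  obtains m :: nat where "m > 0" "m \<le> 3 * ln (1 / \<delta>) / \<epsilon>\<^sup>2" "2 * exp (- 2 * m * \<epsilon>\<^sup>2) \<le> \<delta>"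
proof
  \<comment> \<open>The least \<open>m\<close> for which the Hoeffding bound is at most
    \<delta>.\<close>
  define m where "m = nat \<lceil>ln (2 / \<delta>) / (2 * \<epsilon>\<^sup>2)\<rceil>"
  let ?L = "ln (1 / \<delta>)"
  have e2: "0 < \<epsilon>\<^sup>2" "\<epsilon>\<^sup>2 \<le> 1"
    using assms by (simp_all add: power_le_one)
  have ln2: "1 / 2 \<le> ln (2::real)"
    using ln_le_minus_one[of "1 / 2 :: real"] by (simp add: ln_div)
  have L: "ln 2 \<le> ?L"
    using assms by (subst ln_le_cancel_iff) (auto simp: field_simps)
  have L2: "ln (2 / \<delta>) = ln 2 + ?L"
    using assms by (simp add: ln_div)
  have pos: "0 < ln (2 / \<delta>) / (2 * \<epsilon>\<^sup>2)"
    using L L2 ln2 e2 by simp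
  then show "m > 0"
    by (simp add: m_def)
  have "m \<le> ln (2 / \<delta>) / (2 * \<epsilon>\<^sup>2) + 1"
    using pos unfolding m_def by linarith
  also have "\<dots> \<le> (2 * ?L) / (2 * \<epsilon>\<^sup>2) + 2 * ?L / \<epsilon>\<^sup>2"
  proof (intro add_mono divide_right_mono)
    show "1 \<le> 2 * ?L / \<epsilon>\<^sup>2"
      using L ln2 e2 by (simp add: le_divide_eq)
  qed (use L L2 e2 in auto)
  also have "\<dots> = 3 * ?L / \<epsilon>\<^sup>2"
    by (simp add: field_simps)
  finally show "m \<le> 3 * ?L / \<epsilon>\<^sup>2" .
  have "ln (2 / \<delta>) / (2 * \<epsilon>\<^sup>2) \<le> m"
    unfolding m_def by linarith
  then have "ln (2 / \<delta>) \<le> 2 * m * \<epsilon>\<^sup>2"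
    using e2 by (simp add: field_simps)
  then have "exp (- 2 * m * \<epsilon>\<^sup>2) \<le> exp (- ln (2 / \<delta>))"
    by simp
  also have "\<dots> = \<delta> / 2"
    using assms by (simp add: exp_minus)
  finally show "2 * exp (- 2 * m * \<epsilon>\<^sup>2) \<le> \<delta>"
    by simp
qed

theorem theorem1:
  shows "\<exists>C\<^sub>0 > (0::real). \<forall>(n::nat) (\<alpha>::nat) (\<epsilon>::real) (\<delta>::real).
    n \<ge> 1 \<longrightarrow> \<alpha> \<ge> 1 \<longrightarrow> 0 < \<epsilon> \<longrightarrow> \<epsilon> < 1 \<longrightarrow> 0 < \<delta> \<longrightarrow> \<delta> \<le> 1 / 2 \<longrightarrow>
    (\<exists>(N::nat) (alg :: nat list \<Rightarrow> real pmf).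
       real N \<le> C\<^sub>0 * real \<alpha> * ln (1 / \<delta>) / \<epsilon>\<^sup>2 \<and>
       (\<forall>A \<in> carrier_mat (2 ^ n) (2 ^ n).
          hermitian_mat A \<longrightarrow> mat_trace (A * A) = 2 ^ n \<longrightarrow>
          measure_pmf.prob (replicate_pmf N (measure_basis (pauli_vec n A)) \<bind> alg)
            {p. cmod (complex_of_real p - stab_purity n \<alpha> A) \<le> \<epsilon>} \<ge> 1 - \<delta>))"
proof (intro exI[of _ "3::real"] conjI allI impI)
  fix n \<alpha> :: nat and \<epsilon> \<delta> :: real
  assume \<alpha>: "\<alpha> \<ge> 1" and *: "0 < \<epsilon>" "\<epsilon> < 1" "0 < \<delta>" "\<delta> \<le> 1 / 2"
  obtain m :: nat where m: "m > 0" "m \<le> 3 * ln (1 / \<delta>) / \<epsilon>\<^sup>2" "2 * exp (- 2 * m * \<epsilon>\<^sup>2) \<le> \<delta>"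
    using block_number[OF *] .
  \<comment> \<open>The post-processing is deterministic, hence a point mass.\<close>
  define alg :: "nat list \<Rightarrow> real pmf"
    where "alg = (\<lambda>xs. return_pmf (coincident_blocks \<alpha> m xs / m))"
  show "\<exists>(N::nat) (alg :: nat list \<Rightarrow> real pmf).
       real N \<le> 3 * real \<alpha> * ln (1 / \<delta>) / \<epsilon>\<^sup>2 \<and>
       (\<forall>A \<in> carrier_mat (2 ^ n) (2 ^ n).
          hermitian_mat A \<longrightarrow> mat_trace (A * A) = 2 ^ n \<longrightarrow>
          measure_pmf.prob (replicate_pmf N (measure_basis (pauli_vec n A)) \<bind> alg)
            {p. cmod (complex_of_real p - stab_purity n \<alpha> A) \<le> \<epsilon>} \<ge> 1 - \<delta>)"
  \<comment> \<open>Each of the \<open>m\<close> blocks consumes \<alpha> copies, which is where the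
    factor \<alpha> in the sample bound comes from.\<close>
  proof (intro exI[of _ "m * \<alpha>"] exI[of _ alg] conjI ballI impI)
    show "real (m * \<alpha>) \<le> 3 * real \<alpha> * ln (1 / \<delta>) / \<epsilon>\<^sup>2"
      using mult_right_mono[OF m(2), of "real \<alpha>"] by (simp add: mult_ac)
  next
    fix A :: "complex mat"
    assume A: "A \<in> carrier_mat (2 ^ n) (2 ^ n)" "hermitian_mat A" "mat_trace (A * A) = 2 ^ n"
    let ?p = "measure_basis (pauli_vec n A)"
    have supp: "set_pmf ?p \<subseteq> {..<4 ^ n}"
      by (auto simp: set_pmf_iff pmf_measure_pauli_vec[OF A] split: if_splits)
    have "replicate_pmf (m * \<alpha>) ?p \<bind> alg =
        map_pmf (\<lambda>xs. coincident_blocks \<alpha> m xs / m) (replicate_pmf (m * \<alpha>) ?p)"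
      by (simp add: alg_def map_pmf_def)
    \<comment> \<open>The purity is the embedding of a real number, so the complex modulus becomes a
      real absolute value.\<close>
    then have "measure_pmf.prob (replicate_pmf (m * \<alpha>) ?p \<bind> alg)
        {p. cmod (complex_of_real p - stab_purity n \<alpha> A) \<le> \<epsilon>} =
      measure_pmf.prob (replicate_pmf (m * \<alpha>) ?p)
        {xs. \<bar>coincident_blocks \<alpha> m xs / m - (\<Sum>k<4 ^ n. pmf ?p k ^ \<alpha>)\<bar> \<le> \<epsilon>}"
      unfolding stab_purity_eq[OF A] of_real_diff[symmetric] norm_of_real
      by (simp add: vimage_def)
    then show "measure_pmf.prob (replicate_pmf (m * \<alpha>) ?p \<bind> alg)
        {p. cmod (complex_of_real p - stab_purity n \<alpha> A) \<le> \<epsilon>} \<ge> 1 - \<delta>"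
      using coincident_blocks_estimate[OF finite_lessThan supp \<alpha> m(1), of \<epsilon>] m(3) *(1) by simp
  qed
qed simp

end
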